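(* Let $P$ be a connected finite poset with more than one point. If $E(P)$ contains a crown having an edge $(x,y)$ (i.e. $x<_P y$ with $x,y$ in the crown) such that no improper 4-crown of $P$ contained in $E(P)$ contains both $x$ and $y$, then there is a crown $C$ containing $x$ and $y$ which is a retract of $P$. Moreover, if $P$ has height two and has the fixed point property, then every edge of every crown in $E(P)$ belongs to an hourglass-crown in $E(P)$.
   Context: Subsets of a poset are identified with induced subposets. $L(P)$, $U(P)$: minimal and maximal points; $E(P)=L(P)\cup U(P)$. ${\downarrow}_P z=\{t:t\leq_P z\}$, ${\uparrow}_P z=\{t: z\leq_P t\}$, $[s,t]_P={\uparrow}_P s\cap{\downarrow}_P t$. The height of $P$ is the maximal length of a chain (a chain with $k$ elements has length $k-1$). A subset is a crown if its comparability graph (edges between distinct comparable elements) is a cycle; an edge of a crown is a pair $(x,y)$ of its elements with $x<_P y$. For a 4-crown $D=\{a,b,v,w\}$ with $L(D)=\{a,b\}$, $U(D)=\{v,w\}$, its inner is $\mathcal{I}_P(D)=[a,v]_P\cap[b,w]_P$; $D$ is improper if $\mathcal{I}_P(D)\neq\emptyset$; $D$ is an hourglass-crown if there is $z\in\mathcal{I}_P(D)$ with $\mathcal{I}_P(D)\subseteq{\downarrow}_P z\cup{\uparrow}_P z$. A retraction is an idempotent order homomorphism $r:P\to P$, its image a retract. $P$ has the fixed point property if every order homomorphism $P\to P$ has a fixed point. *)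

theory Defs
  imports Main
begin

text \<open>
  A finite poset is a finite set \<open>P\<close> in a type of class \<^class>\<open>order\<close>, ordered by the restriction
  of \<open>\<le>\<close>. A subset of \<open>P\<close> is thereby the induced subposet, and notions that
  depend only on the induced order carry no reference to an ambient poset.
\<close>

definition min_points :: "'a::order set \<Rightarrow> 'a set" where
  "min_points A = {x \<in> A. \<not> (\<exists>y\<in>A. y < x)}"

definition max_points :: "'a::order set \<Rightarrow> 'a set" where
  "max_points A = {x \<in> A. \<not> (\<exists>y\<in>A. x < y)}"

definition extremal_points :: "'a::order set \<Rightarrow> 'a set" where
  "extremal_points A = min_points A \<union> max_points A"

definition downset :: "'a::order set \<Rightarrow> 'a \<Rightarrow> 'a set" where
  "downset P z = {t \<in> P. t \<le> z}"

definition upset :: "'a::order set \<Rightarrow> 'a \<Rightarrow> 'a set" where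
  "upset P z = {t \<in> P. z \<le> t}"

definition interval :: "'a::order set \<Rightarrow> 'a \<Rightarrow> 'a \<Rightarrow> 'a set" where
  "interval P s t = upset P s \<inter> downset P t"

definition comparability :: "'a::order set \<Rightarrow> 'a rel" where
  "comparability A = {(s, t). s \<in> A \<and> t \<in> A \<and> (s < t \<or> t < s)}"

definition connected_poset :: "'a::order set \<Rightarrow> bool" where
  "connected_poset P \<longleftrightarrow> P \<noteq> {} \<and> (\<forall>s\<in>P. \<forall>t\<in>P. (s, t) \<in> (comparability P)\<^sup>*)"

definition height :: "'a::order set \<Rightarrow> nat" where
  "height P = Max {card K - 1 |K. K \<subseteq> P \<and> K \<noteq> {} \<and> Complete_Partial_Order.chain (\<le>) K}"

text \<open>
  The comparability graph of \<open>C\<close> is a cycle with \<open>n\<close> vertices. The bound \<open>n \<ge> 4\<close> only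
  rules out three-element chains, whose comparability graph is a triangle; they are not crowns.
\<close>

definition crown :: "'a::order set \<Rightarrow> bool" where
  "crown C \<longleftrightarrow> (\<exists>n c. n \<ge> 4 \<and> bij_betw c {..<n::nat} C \<and>
     (\<forall>i<n. \<forall>j<n. (c i, c j) \<in> comparability C \<longleftrightarrow> j = (i + 1) mod n \<or> i = (j + 1) mod n))"

definition crown_edge :: "'a::order set \<Rightarrow> 'a \<Rightarrow> 'a \<Rightarrow> bool" where
  "crown_edge C x y \<longleftrightarrow> x \<in> C \<and> y \<in> C \<and> x < y"

definition four_crown :: "'a::order set \<Rightarrow> 'a \<Rightarrow> 'a \<Rightarrow> 'a \<Rightarrow> 'a \<Rightarrow> bool" where
  "four_crown D a b v w \<longleftrightarrow> crown D \<and> card D = 4 \<and> D = {a, b, v, w} \<and>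
     min_points D = {a, b} \<and> max_points D = {v, w}"

text \<open>
  The inner of a 4-crown does not depend on how its minimal and maximal points are labelled:
  it consists of the points above \<open>a\<close>, \<open>b\<close> and below \<open>v\<close>, \<open>w\<close>. Hence the existential
  quantifiers over labellings in \<open>improper_four_crown\<close> and \<open>hourglass_crown\<close> are harmless.
\<close>

definition inner :: "'a::order set \<Rightarrow> 'a \<Rightarrow> 'a \<Rightarrow> 'a \<Rightarrow> 'a \<Rightarrow> 'a set" where
  "inner P a b v w = interval P a v \<inter> interval P b w"

definition improper_four_crown :: "'a::order set \<Rightarrow> 'a set \<Rightarrow> bool" where
  "improper_four_crown P D \<longleftrightarrow> D \<subseteq> P \<and> (\<exists>a b v w. four_crown D a b v w \<and> inner P a b v w \<noteq> {})"

definition hourglass_crown :: "'a::order set \<Rightarrow> 'a set \<Rightarrow> bool" where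
  "hourglass_crown P D \<longleftrightarrow> D \<subseteq> P \<and> (\<exists>a b v w. four_crown D a b v w \<and>
     (\<exists>z \<in> inner P a b v w. inner P a b v w \<subseteq> downset P z \<union> upset P z))"

definition order_hom :: "'a::order set \<Rightarrow> ('a \<Rightarrow> 'a) \<Rightarrow> bool" where
  "order_hom P f \<longleftrightarrow> f ` P \<subseteq> P \<and> mono_on P f"

definition poset_retract :: "'a::order set \<Rightarrow> 'a set \<Rightarrow> bool" where
  "poset_retract P R \<longleftrightarrow> (\<exists>r. order_hom P r \<and> (\<forall>p\<in>P. r (r p) = r p) \<and> r ` P = R)"

definition fixed_point_property :: "'a::order set \<Rightarrow> bool" where
  "fixed_point_property P \<longleftrightarrow> (\<forall>f. order_hom P f \<longrightarrow> (\<exists>p\<in>P. f p = p))"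

end

theory Submission
  imports Defs
begin

text \<open>
  The edge \<open>(x, y)\<close> lies on a cycle of the comparability graph of the extremal points. A shortest
  path from \<open>x\<close> to \<open>y\<close> avoiding the edge closes up with it to a crown \<open>C\<close>, and sending an extremal
  point at (truncated) distance \<open>k\<close> from \<open>x\<close> to the \<open>k\<close>-th point of the path maps the extremal points
  onto \<open>C\<close>. This map extends to a point \<open>p\<close> as soon as the minimal points below \<open>p\<close>, or the maximal
  points above \<open>p\<close>, have a single image. If both have two images, then \<open>x\<close> lies below and \<open>y\<close> above
  \<open>p\<close>, and \<open>p\<close> is in the inner of an improper 4-crown containing both.

  A crown has no fixed point property, so neither has a poset retracting onto it. In height two,
  an improper 4-crown that is not an hourglass-crown has two incomparable points in its inner, and
  \<open>P\<close> then maps without fixed points onto the 4-crown with these two points added.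
\<close>

section \<open>Crowns and the fixed point property\<close>

text \<open>Cyclic adjacency is spelled out without \<open>mod\<close>, so that whoever builds a
  crown can check it by a plain case distinction.\<close>

lemma crownI:
  assumes "4 \<le> n" "bij_betw c {..<n} C"
    and "\<And>i j. i < n \<Longrightarrow> j < n \<Longrightarrow>
      (c i, c j) \<in> comparability C \<longleftrightarrow> j = Suc i \<or> i = Suc j \<or> (i = 0 \<and> Suc j = n) \<or> (j = 0 \<and> Suc i = n)"
  shows "crown C"
  unfolding crown_def
proof (intro exI conjI allI impI)
  fix i j assume "i < n" "j < n"
  then show "(c i, c j) \<in> comparability C \<longleftrightarrow> j = (i + 1) mod n \<or> i = (j + 1) mod n"
    using assms(1) by (auto simp: assms(3) mod_Suc)
qed (use assms in auto)

lemma crownE: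
  assumes "crown C"
  obtains n c where "4 \<le> n" "bij_betw c {..<n} C"
    "\<And>i j. i < n \<Longrightarrow> j < n \<Longrightarrow> (c i, c j) \<in> comparability C \<longleftrightarrow> j = Suc i mod n \<or> i = Suc j mod n"
  using assms unfolding crown_def by auto

text \<open>Rotating a crown by two positions is monotone, because the directions of the edges
  alternate, and it moves every point. Composed with the retraction it has no fixed point: such a
  point would lie in \<open>C\<close>, where the retraction is the identity.\<close>

lemma not_fixed_point_property_if_crown_retract:
  assumes "crown C" "poset_retract P C"
  shows "\<not> fixed_point_property P"
proof -
  obtain n c where n: "4 \<le> n" and bij: "bij_betw c {..<n} C"
    and adj: "\<And>i j. i < n \<Longrightarrow> j < n \<Longrightarrow>
      (c i, c j) \<in> comparability C \<longleftrightarrow> j = Suc i mod n \<or> i = Suc j mod n"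
    using assms(1) by (rule crownE) blast
  obtain r where r: "order_hom P r" "\<And>p. p \<in> P \<Longrightarrow> r (r p) = r p" "r ` P = C"
    using assms(2) unfolding poset_retract_def by auto
  have CP: "C \<subseteq> P" using r unfolding order_hom_def by auto
  define nxt where "nxt i = Suc i mod n" for i
  have nxt: "nxt i < n" for i using n by (simp add: nxt_def)
  have cC: "i < n \<Longrightarrow> c i \<in> C" for i using bij by (auto simp: bij_betw_def)
  \<comment> \<open>This is where \<open>n\<close> being at least 4 matters: in a triangle, two
    steps forward are one step back.\<close>
  have not_adj: "(c i, c (nxt (nxt i))) \<notin> comparability C" if "i < n" for i
  proof -
    have "nxt (nxt i) \<noteq> nxt i" "i \<noteq> nxt (nxt (nxt i))"
      using that n by (auto simp: nxt_def mod_Suc split: if_splits)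
    then show ?thesis using adj[OF that nxt[of "nxt i"]] by (simp flip: nxt_def)
  qed
  \<comment> \<open>Two consecutive edges in the same direction would, by transitivity, make points
    two positions apart comparable.\<close>
  have flip: "c (nxt (nxt i)) < c (nxt i)" if "i < n" "c i < c (nxt i)" for i
  proof -
    have "(c (nxt i), c (nxt (nxt i))) \<in> comparability C"
      using adj nxt nxt_def by blast
    then show ?thesis
      using that not_adj cC nxt unfolding comparability_def by (auto dest: less_trans)
  qed
  have flip': "c (nxt i) < c (nxt (nxt i))" if "i < n" "c (nxt i) < c i" for i
  proof -
    have "(c (nxt i), c (nxt (nxt i))) \<in> comparability C"
      using adj nxt nxt_def by blast
    then show ?thesis
      using that not_adj cC nxt unfolding comparability_def by (auto dest: less_trans)
  qed
  define idx where "idx = inv_into {..<n} c"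
  have idx: "idx p < n" "c (idx p) = p" if "p \<in> C" for p
  proof -
    have "p \<in> c ` {..<n}" using that bij by (simp add: bij_betw_def)
    from inv_into_into[OF this] f_inv_into_f[OF this]
    show "idx p < n" "c (idx p) = p" by (simp_all add: idx_def)
  qed
  have idx_c: "idx (c i) = i" if "i < n" for i
    using that bij unfolding idx_def by (simp add: bij_betw_inv_into_left)
  define g where "g p = c (nxt (nxt (idx p)))" for p
  have gC: "g p \<in> C" for p using cC nxt by (auto simp: g_def)
  have g_mono: "g p \<le> g q" if "p \<in> C" "q \<in> C" "p \<le> q" for p q
  proof (cases "p = q")
    case False
    then have less: "c (idx p) < c (idx q)" using that idx by simp
    then have "(c (idx p), c (idx q)) \<in> comparability C"
      using that idx by (auto simp: comparability_def)
    then consider "idx q = nxt (idx p)" | "idx p = nxt (idx q)"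
      using adj[of "idx p" "idx q"] idx(1) \<open>p \<in> C\<close> \<open>q \<in> C\<close> by (auto simp: nxt_def)
    then have "g p < g q"
    proof cases
      case 1 then show ?thesis unfolding g_def
        using flip'[OF nxt flip] less that idx by metis
    next
      case 2 then show ?thesis unfolding g_def
        using flip[OF nxt flip'] less that idx by metis
    qed
    then show ?thesis by simp
  qed simp
  have g_neq: "g p \<noteq> p" if "p \<in> C" for p
  proof
    assume "g p = p"
    then have "nxt (nxt (idx p)) = idx p"
      using idx_c[OF nxt, of "nxt (idx p)"] by (simp add: g_def)
    then show False
      using idx(1)[OF that] n by (auto simp: nxt_def mod_Suc split: if_splits)
  qed
  have "order_hom P (g \<circ> r)"
    using r CP gC g_mono unfolding order_hom_def mono_on_def by (auto 4 4)
  moreover have "(g \<circ> r) p \<noteq> p" if "p \<in> P" for p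
  proof
    assume *: "(g \<circ> r) p = p"
    then have "p \<in> C" using gC by (metis comp_apply)
    then have "r p = p" using r by auto
    then show False using * g_neq[OF \<open>p \<in> C\<close>] by simp
  qed
  ultimately show ?thesis unfolding fixed_point_property_def by blast
qed

text \<open>One walks around the crown the other way. The edge is removed in both orientations,
  which keeps the relation symmetric.\<close>

lemma crown_edge_on_cycle:
  assumes "crown C" "x \<in> C" "y \<in> C" "(x, y) \<in> comparability C"
  shows "(x, y) \<in> (comparability C - {(x, y), (y, x)})\<^sup>*"
proof -
  obtain n c where n: "4 \<le> n" and bij: "bij_betw c {..<n} C"
    and adj: "\<And>i j. i < n \<Longrightarrow> j < n \<Longrightarrow>
      (c i, c j) \<in> comparability C \<longleftrightarrow> j = Suc i mod n \<or> i = Suc j mod n"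
    using assms(1) by (rule crownE) blast
  let ?R = "comparability C - {(x, y), (y, x)}"
  have sym: "sym (?R\<^sup>*)"
    by (rule sym_rtrancl) (auto simp: sym_def comparability_def)
  have inj: "c i = c j \<longleftrightarrow> i = j" if "i < n" "j < n" for i j
    using that bij by (auto simp: bij_betw_def inj_on_def)
  have segment: "(c i, c j) \<in> ?R\<^sup>*"
    if "i \<le> j" "j < n" "\<And>k. i \<le> k \<Longrightarrow> k < j \<Longrightarrow> (c k, c (Suc k)) \<notin> {(x, y), (y, x)}" for i j
    using that
  proof (induction j rule: dec_induct)
    case (step j)
    have "(c j, c (Suc j)) \<in> comparability C"
      using adj[of j "Suc j"] step.prems by simp
    then have "(c j, c (Suc j)) \<in> ?R" using step by blast
    then show ?case using step by (meson Suc_lessD less_SucI rtrancl.rtrancl_into_rtrancl)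
  qed simp
  \<comment> \<open>If the removed edge is the closing one, the detour runs through all positions
    from 0 to \<open>n - 1\<close>. Otherwise it runs from \<open>i\<close> down to 0, over the
    closing edge to \<open>n - 1\<close>, and down to \<open>j\<close>.\<close>
  have key: "(c i, c j) \<in> ?R\<^sup>*"
    if ij: "i < n" "j < n" "j = Suc i mod n" and xy: "{x, y} = {c i, c j}" for i j
  proof (cases "Suc i = n")
    case True
    have "(c j, c i) \<in> ?R\<^sup>*"
    proof (rule segment)
      fix k assume "j \<le> k" "k < i"
      then show "(c k, c (Suc k)) \<notin> {(x, y), (y, x)}"
        using ij True n xy by (auto simp: doubleton_eq_iff inj)
    qed (use ij True in \<open>auto simp: mod_Suc\<close>)
    then show ?thesis using sym by (meson symD)
  next
    case False
    then have j: "j = Suc i" using ij by (simp add: mod_Suc)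
    have 1: "(c 0, c i) \<in> ?R\<^sup>*"
    proof (rule segment)
      fix k assume "0 \<le> k" "k < i"
      then show "(c k, c (Suc k)) \<notin> {(x, y), (y, x)}"
        using ij j xy by (auto simp: doubleton_eq_iff inj)
    qed (use ij in auto)
    have 2: "(c j, c (n - 1)) \<in> ?R\<^sup>*"
    proof (rule segment)
      fix k assume "j \<le> k" "k < n - 1"
      then show "(c k, c (Suc k)) \<notin> {(x, y), (y, x)}"
        using ij j xy by (auto simp: doubleton_eq_iff inj)
    qed (use ij j in auto)
    have "(c 0, c (n - 1)) \<in> comparability C"
      using adj[of 0 "n - 1"] n by auto
    moreover have "(c 0, c (n - 1)) \<notin> {(x, y), (y, x)}"
      using ij(1,2) j xy n by (auto simp: doubleton_eq_iff inj)
    ultimately have 3: "(c 0, c (n - 1)) \<in> ?R\<^sup>*" by blast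
    from 1 2 3 sym show ?thesis by (meson rtrancl_trans symD)
  qed
  obtain i j where ij: "i < n" "j < n" "x = c i" "y = c j"
    using assms(2,3) bij by (auto simp: bij_betw_def)
  then have "j = Suc i mod n \<or> i = Suc j mod n" using adj assms(4) by blast
  then show ?thesis using key[of i j] key[of j i] ij sym by (auto dest: symD)
qed

lemma four_crownI:
  assumes "a < v" "a < w" "b < v" "b < w" "\<not> a < b" "\<not> b < a" "\<not> v < w" "\<not> w < v"
    "a \<noteq> b" "v \<noteq> w"
  shows "four_crown {a, b, v, w} a b v w"
proof -
  let ?D = "{a, b, v, w}"
  have d: "a \<noteq> v" "a \<noteq> w" "b \<noteq> v" "b \<noteq> w" and n: "\<not> v < a" "\<not> w < a" "\<not> v < b" "\<not> w < b"
    using assms by auto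
  define c :: "nat \<Rightarrow> 'a" where "c k = (if k = 0 then a else if k = 1 then v else if k = 2 then b else w)" for k
  have lt: "{..<4::nat} = {0, 1, 2, 3}" by auto
  have "crown ?D"
  proof (rule crownI[of 4 c])
    show "bij_betw c {..<4} ?D"
      using assms d by (auto simp: bij_betw_def lt c_def)
    fix i j :: nat assume "i < 4" "j < 4"
    then have "i \<in> {0, 1, 2, 3}" "j \<in> {0, 1, 2, 3}" by auto
    then show "(c i, c j) \<in> comparability ?D \<longleftrightarrow>
        j = Suc i \<or> i = Suc j \<or> (i = 0 \<and> Suc j = 4) \<or> (j = 0 \<and> Suc i = 4)"
      using assms d n by (auto simp: c_def comparability_def)
  qed simp
  moreover have "card ?D = 4" using assms d by simp
  moreover have "min_points ?D = {a, b}" "max_points ?D = {v, w}"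
    using assms d n by (auto simp: min_points_def max_points_def)
  ultimately show ?thesis unfolding four_crown_def by simp
qed

section \<open>Extending maps from the extremal points\<close>

lemma min_point_below:
  assumes "finite P" "p \<in> P"
  obtains l where "l \<in> min_points P" "l \<le> p"
  using finite_has_minimal2[OF assms] unfolding min_points_def
  by (auto simp: less_le_not_le)

lemma max_point_above:
  assumes "finite P" "p \<in> P"
  obtains u where "u \<in> max_points P" "p \<le> u"
  using finite_has_maximal2[OF assms] unfolding max_points_def
  by (auto simp: less_le_not_le)

text \<open>A point goes to the only element of \<open>lo p\<close> or, failing that, of
  \<open>up p\<close>. As \<open>p\<close> increases, \<open>lo p\<close> grows and
  \<open>up p\<close> shrinks, and each element of \<open>lo p\<close> is below each element of
  \<open>up q\<close> whenever \<open>p\<close> is below \<open>q\<close>; this makes the choices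
  compatible.\<close>

lemma mono_extension:
  fixes P :: "'a::order set" and h :: "'a \<Rightarrow> 'a"
  defines "lo \<equiv> \<lambda>p. h ` (min_points P \<inter> downset P p)"
    and "up \<equiv> \<lambda>p. h ` (max_points P \<inter> upset P p)"
  assumes fin: "finite P"
    and mono: "\<And>l u. l \<in> min_points P \<Longrightarrow> u \<in> max_points P \<Longrightarrow> l \<le> u \<Longrightarrow> h l \<le> h u"
    and single: "\<And>p. p \<in> P \<Longrightarrow> is_singleton (lo p) \<or> is_singleton (up p)"
  obtains r where "mono_on P r" "\<And>e. e \<in> extremal_points P \<Longrightarrow> r e = h e"
    "r ` P \<subseteq> h ` extremal_points P"
proof
  \<comment> \<open>Maximal points are treated first: below one of them \<open>lo\<close> may be a
    singleton with a value other than that of \<open>h\<close>. At a minimal point \<open>lo\<close>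
    gives the value of \<open>h\<close> anyway.\<close>
  define r where "r p = (if p \<in> max_points P then h p
    else if is_singleton (lo p) then the_elem (lo p) else the_elem (up p))" for p
  have lo_up: "a \<le> b" if "p \<in> P" "q \<in> P" "p \<le> q" "a \<in> lo p" "b \<in> up q" for a b p q
    using that mono unfolding lo_def up_def downset_def upset_def
    by (smt (verit) IntD1 IntD2 imageE mem_Collect_eq order_trans)
  have lo_anti: "lo p \<subseteq> lo q" and up_anti: "up q \<subseteq> up p" if "p \<le> q" for p q
    using that unfolding lo_def up_def downset_def upset_def by (auto intro: order_trans)
  have lo_ne: "lo p \<noteq> {}" if "p \<in> P" for p
  proof -
    obtain l where "l \<in> min_points P" "l \<le> p" using min_point_below[OF fin \<open>p \<in> P\<close>] .
    then show ?thesis by (auto simp: lo_def downset_def min_points_def)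
  qed
  have lo_min: "lo p = {h p}" if "p \<in> min_points P" for p
  proof -
    have "min_points P \<inter> downset P p = {p}"
      using that by (auto simp: min_points_def downset_def order_le_less)
    then show ?thesis by (simp add: lo_def)
  qed
  have r1: "r p \<in> lo p" "lo p = {r p}" if "p \<notin> max_points P" "is_singleton (lo p)" for p
    using that by (auto simp: r_def is_singleton_the_elem)
  have r2: "up p = {r p}" if "p \<in> P" "p \<notin> max_points P" "\<not> is_singleton (lo p)" for p
    using that single[OF that(1)] by (simp add: r_def is_singleton_the_elem)
  have r_max: "r p = h p" if "p \<in> max_points P" for p using that by (simp add: r_def)
  show rh: "r e = h e" if "e \<in> extremal_points P" for e
    using that r_max r1(2)[of e] lo_min unfolding extremal_points_def by fastforce
  show "r ` P \<subseteq> h ` extremal_points P"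
  proof
    fix q assume "q \<in> r ` P"
    then obtain p where p: "p \<in> P" "q = r p" by auto
    have "lo p \<subseteq> h ` extremal_points P" "up p \<subseteq> h ` extremal_points P"
      by (auto simp: lo_def up_def extremal_points_def)
    then show "q \<in> h ` extremal_points P"
      using p r1(1)[of p] r2[of p] r_max[of p] by (auto simp: extremal_points_def)
  qed
  show "mono_on P r"
  proof (rule mono_onI)
    fix p q assume pq: "p \<in> P" "q \<in> P" "p \<le> q"
    consider "p = q" | "p \<notin> max_points P" "q \<in> max_points P" 
      | "p \<notin> max_points P" "q \<notin> max_points P"
      using pq unfolding max_points_def by fastforce
    then show "r p \<le> r q"
    proof cases
      case 2
      have q: "r q \<in> up q" "r q \<in> up p"
        using 2 pq by (auto simp: r_max up_def upset_def)
      show ?thesis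
        using r1[of p] r2[of p] 2 q lo_up[OF pq(1,1) order_refl] pq by (cases "is_singleton (lo p)") auto
    next
      case 3
      show ?thesis
      proof (cases "is_singleton (lo q)")
        \<comment> \<open>A nonempty subset of a singleton equals it, so \<open>p\<close> is also
          sent by \<open>lo\<close>. Hence a point sent by \<open>up\<close> never lies below a
          nonmaximal point sent by \<open>lo\<close>.\<close>
        case True
        then have "lo p = lo q" using lo_anti[OF pq(3)] lo_ne[OF pq(1)]
          by (metis is_singletonE subset_singletonD)
        then show ?thesis using r1(2)[of p] r1(2)[of q] 3 True by simp
      next
        case q: False
        show ?thesis
        proof (cases "is_singleton (lo p)")
          case True
          then show ?thesis using lo_up[OF pq] r1(1)[of p] r2[of q] 3 pq q by auto
        next
          case False
          then show ?thesis using r2[of p] r2[of q] 3 pq q up_anti[OF pq(3)] by auto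
        qed
      qed
    qed simp
  qed
qed

section \<open>Retracting onto a crown through an edge\<close>

text \<open>All that \<open>cycle\<close> keeps of a given crown is that its edge can be bypassed.
  The crown obtained comes from a shortest bypass and may be a different one.\<close>

lemma crown_retract_through_edge:
  fixes P :: "'a::order set"
  assumes fin: "finite P" and x: "x \<in> min_points P" and y: "y \<in> max_points P" and xy: "x < y"
    and cycle: "(x, y) \<in> (comparability (extremal_points P) - {(x, y), (y, x)})\<^sup>*"
    and proper: "\<not> (\<exists>D. improper_four_crown P D \<and> D \<subseteq> extremal_points P \<and> x \<in> D \<and> y \<in> D)"
  shows "\<exists>C. crown C \<and> C \<subseteq> P \<and> x \<in> C \<and> y \<in> C \<and> poset_retract P C"
proof -
  let ?E = "extremal_points P"
  define R where "R = comparability ?E - {(x, y), (y, x)}"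
  have EP: "?E \<subseteq> P" by (auto simp: extremal_points_def min_points_def max_points_def)
  have min_not_max: "l \<notin> max_points P" if "l \<in> min_points P" "u \<in> P" "l < u" for l u
    using that by (auto simp: max_points_def)
  have bipartite: "s \<in> min_points P \<and> s \<notin> max_points P \<and> t \<in> max_points P"
    if "s \<in> ?E" "t \<in> ?E" "s < t" for s t
    using that by (auto simp: extremal_points_def min_points_def max_points_def)
  have R_max: "t \<in> max_points P \<longleftrightarrow> s \<notin> max_points P" if "(s, t) \<in> R" for s t
    using that bipartite unfolding R_def comparability_def by blast
  have R_sym: "(t, s) \<in> R" if "(s, t) \<in> R" for s t
    using that by (auto simp: R_def comparability_def)
  have x_max: "x \<notin> max_points P"
    using min_not_max[OF x _ xy] y EP by (auto simp: extremal_points_def)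

  define m where "m = (LEAST k. (x, y) \<in> R ^^ k)"
  have "\<exists>k. (x, y) \<in> R ^^ k" using cycle by (simp add: R_def rtrancl_power)
  then have m: "(x, y) \<in> R ^^ m" unfolding m_def by (rule LeastI_ex)
  have m_le: "m \<le> k" if "(x, y) \<in> R ^^ k" for k
    unfolding m_def using that by (rule Least_le)
  have parity: "odd k \<longleftrightarrow> e \<in> max_points P" if "(x, e) \<in> R ^^ k" for e k
    using that
  proof (induction k arbitrary: e)
    case (Suc k)
    then show ?case by (auto dest!: R_max)
  qed (use x_max in simp)
  \<comment> \<open>Walks in \<open>R\<close> alternate between maximal and nonmaximal points, and
    the direct edge is deleted. So a bypass has at least three edges, and the closed cycle at least
    four points.\<close>
  have "odd m" using parity[OF m] y by simp
  moreover have "m \<noteq> 1" using m xy by (auto simp: R_def)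
  ultimately have m3: "3 \<le> m" by presburger

  \<comment> \<open>The cutoff has the parity that any walk from \<open>x\<close> to
    \<open>e\<close> would have. It is also the value for points that no walk from \<open>x\<close>
    reaches.\<close>
  define cap where "cap e = (if e \<in> max_points P then m else m - 1)" for e
  \<comment> \<open>the distance from \<open>x\<close> in the comparability graph of the extremal points without the edge
    \<open>(x, y)\<close>, truncated in a way that preserves parity\<close>
  define f where "f e = (LEAST k. cap e \<le> k \<or> (x, e) \<in> R ^^ k)" for e
  have f_cases: "f e = cap e \<or> (x, e) \<in> R ^^ f e" and f_le_cap: "f e \<le> cap e" for e
  proof -
    show "f e \<le> cap e" unfolding f_def by (rule Least_le) simp
    moreover have "cap e \<le> f e \<or> (x, e) \<in> R ^^ f e"
      unfolding f_def by (rule LeastI[of _ "cap e"]) simp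
    ultimately show "f e = cap e \<or> (x, e) \<in> R ^^ f e" by auto
  qed
  have f_le: "f e \<le> k" if "(x, e) \<in> R ^^ k" for e k
    unfolding f_def using that by (auto intro: Least_le)
  have f_le_m: "f e \<le> m" for e using f_le_cap[of e] by (auto simp: cap_def split: if_splits)
  have f_parity: "odd (f e) \<longleftrightarrow> e \<in> max_points P" for e
    using f_cases[of e] parity[of e "f e"] \<open>odd m\<close> m3 by (auto simp: cap_def split: if_splits)
  have f_step: "f t \<le> Suc (f s)" if "(s, t) \<in> R" for s t
  proof (cases "(x, s) \<in> R ^^ f s")
    case True
    then have "(x, t) \<in> R ^^ Suc (f s)" using that by auto
    then show ?thesis by (rule f_le)
  next
    case False
    then have "f s = cap s" using f_cases by blast
    moreover have "cap t \<le> Suc (cap s)" by (auto simp: cap_def)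
    ultimately show ?thesis using f_le_cap[of t] by simp
  qed
  \<comment> \<open>Values at adjacent points differ by at most one, and parity excludes equality.
    So edges of \<open>R\<close> are sent to edges of the path and never collapsed.\<close>
  have f_R: "f t = Suc (f s) \<or> f s = Suc (f t)" if "(s, t) \<in> R" for s t
  proof -
    have "odd (f t) \<longleftrightarrow> even (f s)" using R_max[OF that] f_parity[of s] f_parity[of t] by blast
    then have "f t \<noteq> f s" by auto
    then show ?thesis using f_step[OF that] f_step[OF R_sym[OF that]] by linarith
  qed

  obtain c where c: "c 0 = x" "c m = y" "\<And>i. i < m \<Longrightarrow> (c i, c (Suc i)) \<in> R"
    using m unfolding relpow_fun_conv by auto
  have c_E: "c i \<in> ?E" if "i \<le> m" for i
    using that c(3)[of i] c(2) y
    by (cases "i = m") (auto simp: R_def comparability_def extremal_points_def)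
  have c_start: "(x, c i) \<in> R ^^ i" if "i \<le> m" for i
    using that unfolding relpow_fun_conv by (intro exI[of _ c]) (auto simp: c)
  have c_end: "(c i, y) \<in> R ^^ (m - i)" if "i \<le> m" for i
    using that unfolding relpow_fun_conv by (intro exI[of _ "\<lambda>k. c (i + k)"]) (auto simp: c)
  have f_c: "f (c i) = i" if "i \<le> m" for i
  proof (rule antisym)
    show "f (c i) \<le> i" using f_le c_start that by blast
    \<comment> \<open>A shorter walk to \<open>c i\<close>, continued along the path, would reach
      \<open>y\<close> in fewer than \<open>m\<close> steps. The cutoff does no harm, being at least
      \<open>m - 1\<close>, and \<open>m\<close> at \<open>y\<close>.\<close>
    show "i \<le> f (c i)"
    proof (cases "(x, c i) \<in> R ^^ f (c i)")
      case True
      then have "(x, y) \<in> R ^^ (f (c i) + (m - i))"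
        using c_end[OF that] by (auto simp: relpow_add)
      then show ?thesis using m_le that by fastforce
    next
      case False
      then have "f (c i) = cap (c i)" using f_cases by blast
      moreover have "odd i \<longleftrightarrow> c i \<in> max_points P" using parity c_start that by blast
      then have "i \<le> cap (c i)" using that \<open>odd m\<close> by (cases "i = m") (auto simp: cap_def)
      ultimately show ?thesis by simp
    qed
  qed

  define C where "C = c ` {..<Suc m}"
  have CE: "C \<subseteq> ?E" using c_E by (auto simp: C_def)
  have crown: "crown C"
  proof (rule crownI)
    show "4 \<le> Suc m" using m3 by simp
    show "bij_betw c {..<Suc m} C"
      unfolding bij_betw_def C_def by (auto intro!: inj_on_inverseI[of _ f] simp: f_c)
    fix i j assume ij: "i < Suc m" "j < Suc m"
    have comp: "(c i, c j) \<in> comparability C \<longleftrightarrow> (c i, c j) \<in> comparability ?E"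
      using ij c_E by (auto simp: comparability_def C_def)
    show "(c i, c j) \<in> comparability C \<longleftrightarrow>
        j = Suc i \<or> i = Suc j \<or> (i = 0 \<and> Suc j = Suc m) \<or> (j = 0 \<and> Suc i = Suc m)"
    proof
      assume "(c i, c j) \<in> comparability C"
      \<comment> \<open>There are no chords: \<open>f\<close> recovers the index on the path, so by
        \<open>f_R\<close> an edge of \<open>R\<close> joins consecutive points. Only the deleted
        edge remains, and it closes the cycle.\<close>
      then consider "(c i, c j) \<in> R" | "c i = x" "c j = y" | "c i = y" "c j = x"
        using comp by (auto simp: R_def)
      then show "j = Suc i \<or> i = Suc j \<or> (i = 0 \<and> Suc j = Suc m) \<or> (j = 0 \<and> Suc i = Suc m)"
      proof cases
        case 1
        then show ?thesis using f_R[OF 1] ij by (auto simp: f_c)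
      next
        case 2
        then show ?thesis using ij f_c[of i] f_c[of j] f_c[of 0] f_c[of m] c by simp
      next
        case 3
        then show ?thesis using ij f_c[of i] f_c[of j] f_c[of 0] f_c[of m] c by simp
      qed
    next
      assume "j = Suc i \<or> i = Suc j \<or> (i = 0 \<and> Suc j = Suc m) \<or> (j = 0 \<and> Suc i = Suc m)"
      then consider "j = Suc i" | "i = Suc j" | "i = 0" "j = m" | "j = 0" "i = m" by auto
      then have "(c i, c j) \<in> R \<union> {(x, y), (y, x)}"
        using c ij R_sym by cases auto
      then show "(c i, c j) \<in> comparability C"
        using comp xy c_E[of 0] c_E[of m] c by (auto simp: R_def comparability_def)
    qed
  qed

  define h where "h e = c (f e)" for e
  have h_C: "h e \<in> C" for e using f_le_m[of e] by (auto simp: h_def C_def)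
  have h_c: "h p = p" if "p \<in> C" for p using that by (auto simp: C_def h_def f_c)
  have h_less: "h l < h u" if lu: "l \<in> min_points P" "u \<in> max_points P" "l < u" for l u
  proof (cases "l = x \<and> u = y")
    case True
    then show ?thesis using f_c[of 0] f_c[of m] c xy by (simp add: h_def)
  next
    case False
    have "l \<notin> max_points P" using min_not_max lu by (auto simp: max_points_def)
    have "(l, u) \<noteq> (y, x)" using y lu \<open>l \<notin> max_points P\<close> by auto
    then have "(l, u) \<in> R"
      using False lu by (auto simp: R_def comparability_def extremal_points_def)
    then have "(h l, h u) \<in> R"
      using f_R[of l u] f_le_m[of l] f_le_m[of u] c(3) R_sym unfolding h_def
      by (metis Suc_le_eq)
    \<comment> \<open>Adjacency of the images leaves the direction open; parity settles it.\<close>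
    moreover have "h u \<in> max_points P"
      using f_parity[of "h u"] f_parity[of u] lu(2) f_c[OF f_le_m[of u]] by (simp add: h_def)
    ultimately show ?thesis by (auto simp: R_def comparability_def max_points_def extremal_points_def min_points_def)
  qed
  obtain r where r: "mono_on P r" "\<And>e. e \<in> ?E \<Longrightarrow> r e = h e" "r ` P \<subseteq> h ` ?E"
  proof (rule mono_extension[OF fin])
    show "h l \<le> h u" if "l \<in> min_points P" "u \<in> max_points P" "l \<le> u" for l u
      using h_less[OF that(1,2)] that(3) by (auto simp: order_le_less)
    fix p assume p: "p \<in> P"
    let ?A = "min_points P \<inter> downset P p" and ?B = "max_points P \<inter> upset P p"
    obtain l0 where l0: "l0 \<in> ?A"
      using min_point_below[OF fin p] by (auto simp: downset_def min_points_def)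
    obtain u0 where u0: "u0 \<in> ?B"
      using max_point_above[OF fin p] by (auto simp: upset_def max_points_def)
    show "is_singleton (h ` ?A) \<or> is_singleton (h ` ?B)"
    proof (rule ccontr)
      assume "\<not> ?thesis"
      then have A: "\<not> is_singleton (h ` ?A)" and B: "\<not> is_singleton (h ` ?B)" by auto
      have A1: "\<exists>a'\<in>?A. h a' \<noteq> h a" if "a \<in> ?A" for a
      proof (rule ccontr)
        assume "\<not> ?thesis"
        then have "h ` ?A = {h a}" using that by blast
        then show False using A by (simp add: is_singleton_def)
      qed
      have B1: "\<exists>b'\<in>?B. h b' \<noteq> h b" if "b \<in> ?B" for b
      proof (rule ccontr)
        assume "\<not> ?thesis"
        then have "h ` ?B = {h b}" using that by blast
        then show False using B by (simp add: is_singleton_def)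
      qed
      obtain l1 where l1: "l1 \<in> ?A" "h l1 \<noteq> h l0" using A1[OF l0] by auto
      obtain u1 where u1: "u1 \<in> ?B" "h u1 \<noteq> h u0" using B1[OF u0] by auto
      \<comment> \<open>Different images come from different points, so \<open>p\<close> has two
        minimal points below it and two maximal points above it. It is therefore neither minimal nor
        maximal, and the comparisons are strict.\<close>
      have "p \<notin> min_points P"
        using l0 l1 by (auto simp: min_points_def downset_def order_le_less)
      then have lp: "l < p" if "l \<in> ?A" for l
        using that by (auto simp: downset_def order_le_less)
      have "p \<notin> max_points P"
        using u0 u1 by (auto simp: max_points_def upset_def order_le_less)
      then have pu: "p < u" if "u \<in> ?B" for u
        using that by (auto simp: upset_def order_le_less)
      show False
      proof (cases "x \<in> ?A \<and> y \<in> ?B")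
        case True
        obtain a where a: "a \<in> ?A" "a \<noteq> x" using A1[of x] True by auto
        obtain b where b: "b \<in> ?B" "b \<noteq> y" using B1[of y] True by auto
        have fc: "four_crown {x, a, y, b} x a y b"
          using True a b lp pu
          by (intro four_crownI) (auto simp: min_points_def max_points_def intro: less_trans)
        have "p \<in> inner P x a y b"
          using True a b p by (auto simp: inner_def interval_def downset_def upset_def)
        then have "improper_four_crown P {x, a, y, b}"
          unfolding improper_four_crown_def
        proof (intro conjI exI)
          show "{x, a, y, b} \<subseteq> P" using True a b by (auto simp: min_points_def max_points_def)
          show "inner P x a y b \<noteq> {}" using \<open>p \<in> inner P x a y b\<close> by blast
        qed (rule fc)
        moreover have "{x, a, y, b} \<subseteq> ?E" using True a b by (auto simp: extremal_points_def)
        ultimately show False using proper by blast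
      next
        case False
        \<comment> \<open>The deleted edge is not among these pairs, so every minimal point below
          \<open>p\<close> is adjacent in \<open>R\<close> to every maximal point above
          \<open>p\<close>.\<close>
        have AB: "(l, u) \<in> R" if "l \<in> ?A" "u \<in> ?B" for l u
        proof -
          have "l < u" using lp pu that by (meson less_trans)
          moreover have "(l, u) \<noteq> (y, x)" using \<open>l < u\<close> xy by auto
          ultimately show ?thesis
            using False that by (auto simp: R_def comparability_def extremal_points_def)
        qed
        \<comment> \<open>Both \<open>f u0\<close> and \<open>f u1\<close> are at distance one from
          the distinct numbers \<open>f l0\<close> and \<open>f l1\<close>. Each is then their
          midpoint, so they coincide, a contradiction.\<close>
        have "f l0 \<noteq> f l1" "f u0 \<noteq> f u1" using l1 u1 by (auto simp: h_def)
        then show False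
          using f_R[OF AB[OF l0 u0]] f_R[OF AB[OF l0 u1(1)]] f_R[OF AB[OF l1(1) u0]]
            f_R[OF AB[OF l1(1) u1(1)]] by linarith
      qed
    qed
  qed blast
  have r_C: "r p = p" if "p \<in> C" for p using that r(2) CE h_c by auto
  have "r ` P = C"
    using r(3) h_C r_C CE EP by (force simp: image_iff)
  then have "poset_retract P C"
    using r(1) r_C CE EP unfolding poset_retract_def order_hom_def by blast
  moreover have "x \<in> C" "y \<in> C" using c by (auto simp: C_def)
  ultimately show ?thesis using crown CE EP by blast
qed

section \<open>Height two and hourglass-crowns\<close>

lemma chain_card_le_height:
  assumes "finite P" "K \<subseteq> P" "K \<noteq> {}" "Complete_Partial_Order.chain (\<le>) K"
  shows "card K - 1 \<le> height P"
  unfolding height_def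
proof (rule Max_ge)
  have "finite ((\<lambda>K. card K - 1) ` Pow P)" using assms(1) by simp
  then show "finite {card K - 1 |K. K \<subseteq> P \<and> K \<noteq> {} \<and> Complete_Partial_Order.chain (\<le>) K}"
    by (rule rev_finite_subset) auto
qed (use assms in auto)

text \<open>If no point of the inner is comparable to all the others, any \<open>z\<close> in it has
  an incomparable partner \<open>z'\<close>. Minimal, middle and maximal points can then each be
  sent to a pair on their own level, with the members of the pair swapped, so that nothing is
  fixed.\<close>

lemma hourglass_if_improper_height_two:
  fixes P :: "'a::order set"
  assumes fin: "finite P" and height: "height P = 2" and fpp: "fixed_point_property P"
    and D: "improper_four_crown P D" "D \<subseteq> extremal_points P"
  shows "hourglass_crown P D"
proof (rule ccontr)
  assume no_hourglass: "\<not> hourglass_crown P D"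
  obtain x a y b where DP: "D \<subseteq> P" and fc: "four_crown D x a y b"
    and ne: "inner P x a y b \<noteq> {}"
    using D(1) unfolding improper_four_crown_def by blast
  obtain z where z: "z \<in> inner P x a y b" using ne by auto
  have "\<not> inner P x a y b \<subseteq> downset P z \<union> upset P z"
    using no_hourglass DP fc z unfolding hourglass_crown_def by blast
  then obtain z' where z': "z' \<in> inner P x a y b" "z' \<notin> downset P z \<union> upset P z" by auto
  have z'P: "z' \<in> P" using z' by (auto simp: inner_def interval_def downset_def)
  have zP: "z \<in> P" using z by (auto simp: inner_def interval_def downset_def)
  have zz': "z \<noteq> z'" using z' z'P by (auto simp: downset_def)
  have le: "x \<le> q" "a \<le> q" "q \<le> y" "q \<le> b" if "q \<in> {z, z'}" for q
    using that z z' by (auto simp: inner_def interval_def downset_def upset_def)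
  have P4: "x \<in> P" "a \<in> P" "y \<in> P" "b \<in> P" using DP fc by (auto simp: four_crown_def)
  have neq: "x \<noteq> a" "y \<noteq> b"
    using fc by (auto simp: four_crown_def card_insert_if split: if_splits)
  let ?L = "min_points P" and ?U = "max_points P"
  \<comment> \<open>Such \<open>s\<close> and \<open>t\<close> would extend to a chain of four
    elements. Hence the middle points form an antichain, and every strict comparison goes to a
    higher level.\<close>
  have no_chain: False if st: "s \<in> P - ?L" "t \<in> P - ?U" "s < t" for s t
  proof -
    obtain l where l: "l \<in> P" "l < s" using st by (auto simp: min_points_def)
    obtain u where u: "u \<in> P" "t < u" using st by (auto simp: max_points_def)
    have lt: "l < t" "s < u" "l < u" using l u that by (auto intro: less_trans)
    have "Complete_Partial_Order.chain (\<le>) {l, s, t, u}"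
      using l u that lt by (auto simp: chain_def)
    then have "card {l, s, t, u} - 1 \<le> height P"
      using l u that by (intro chain_card_le_height[OF fin]) auto
    moreover have "card {l, s, t, u} = 4" using l u that lt by (auto simp: card_insert_if)
    ultimately show False using height by simp
  qed
  \<comment> \<open>\<open>{x, a}\<close>, \<open>{z, z'}\<close> and \<open>{y, b}\<close> form an ordinal sum of two-element antichains, so every map that
    sends the three levels of \<open>P\<close> into them is monotone\<close>
  define g where "g p = (if p \<in> ?L then if p = x then a else x
     else if p \<in> ?U then if p = y then b else y
     else if p = z then z' else z)" for p
  have g_mono: "g s \<le> g t" if "s \<in> P" "t \<in> P" "s < t" for s t
  proof -
    have "t \<notin> ?L" "s \<notin> ?U" using that by (auto simp: min_points_def max_points_def)
    moreover have "s \<in> ?L \<or> t \<in> ?U" using no_chain[of s t] that calculation by auto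
    moreover have "x \<le> y" "x \<le> b" "a \<le> y" "a \<le> b" using le[of z] by (auto intro: order_trans)
    ultimately show ?thesis using le by (auto simp: g_def)
  qed
  have "order_hom P g"
    unfolding order_hom_def
  proof
    show "g ` P \<subseteq> P" using P4 zP z'P by (auto simp: g_def)
    show "mono_on P g"
    proof (rule mono_onI)
      fix s t assume "s \<in> P" "t \<in> P" "s \<le> t"
      then show "g s \<le> g t" using g_mono by (cases "s = t") auto
    qed
  qed
  moreover have "g p \<noteq> p" for p using neq zz' by (auto simp: g_def)
  ultimately show False using fpp unfolding fixed_point_property_def by blast
qed

section \<open>Both claims combined\<close>

theorem theorem5:
  fixes P :: "'a::order set"
  assumes "finite P" and "connected_poset P" and "card P > 1"
  shows "(\<forall>C x y. crown C \<and> C \<subseteq> extremal_points P \<and> crown_edge C x y \<and>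
            \<not> (\<exists>D. improper_four_crown P D \<and> D \<subseteq> extremal_points P \<and> x \<in> D \<and> y \<in> D)
            \<longrightarrow> (\<exists>C'. crown C' \<and> C' \<subseteq> P \<and> x \<in> C' \<and> y \<in> C' \<and> poset_retract P C'))
       \<and> (height P = 2 \<and> fixed_point_property P
            \<longrightarrow> (\<forall>C x y. crown C \<and> C \<subseteq> extremal_points P \<and> crown_edge C x y
                  \<longrightarrow> (\<exists>D. hourglass_crown P D \<and> D \<subseteq> extremal_points P \<and> x \<in> D \<and> y \<in> D)))"
proof -
  have min_max: "x \<in> min_points P" "y \<in> max_points P"
    if "C \<subseteq> extremal_points P" "crown_edge C x y" for C x y
    using that unfolding crown_edge_def extremal_points_def min_points_def max_points_def by blast+
  have retract: "\<exists>C'. crown C' \<and> C' \<subseteq> P \<and> x \<in> C' \<and> y \<in> C' \<and> poset_retract P C'"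
    if C: "crown C" "C \<subseteq> extremal_points P" "crown_edge C x y"
      and proper: "\<not> (\<exists>D. improper_four_crown P D \<and> D \<subseteq> extremal_points P \<and> x \<in> D \<and> y \<in> D)"
    for C x y
  proof (rule crown_retract_through_edge)
    have edge: "x \<in> C" "y \<in> C" "x < y" using C(3) by (auto simp: crown_edge_def)
    then have "(x, y) \<in> (comparability C - {(x, y), (y, x)})\<^sup>*"
      by (intro crown_edge_on_cycle C(1)) (auto simp: comparability_def)
    moreover have "comparability C \<subseteq> comparability (extremal_points P)"
      using C(2) by (auto simp: comparability_def)
    ultimately show "(x, y) \<in> (comparability (extremal_points P) - {(x, y), (y, x)})\<^sup>*"
      by (meson Diff_mono order_refl rtrancl_mono subsetD)
    show "x < y" by fact
  qed (use assms(1) min_max C proper in blast)+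
  \<comment> \<open>The fixed point property excludes crown retracts, so the first claim, read
    backwards, supplies an improper 4-crown through the edge.\<close>
  have hourglass: "\<exists>D. hourglass_crown P D \<and> D \<subseteq> extremal_points P \<and> x \<in> D \<and> y \<in> D"
    if "height P = 2" "fixed_point_property P"
      and C: "crown C" "C \<subseteq> extremal_points P" "crown_edge C x y" for C x y
    using retract[OF C] not_fixed_point_property_if_crown_retract that(2)
      hourglass_if_improper_height_two[OF assms(1) that(1,2)] by meson
  show ?thesis using retract hourglass by blast
qed

end
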